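(* The set $\{(e,\vec y,a)\mid \text{for all special fan functionals }\Theta,\ \{e\}(\Theta,\mu,\vec y)=a\}$ is $\Pi^1_1$, where $e$ ranges over Kleene indices, $\vec y$ ranges over all finite sequences of non-negative integers, and $a\in\mathbb N$.
   Context: $C=2^{\mathbb N}$; $C_s$ is the basic neighbourhood of binary extensions of the finite binary sequence $s$; $\bar g n=\langle g(0),\dots,g(n-1)\rangle$. A special fan functional is a functional $\Theta$ assigning to every $F:\mathbb{N}^{\mathbb N}\to\mathbb N$ a finite sequence $\Theta(F)=\langle g_1,\dots,g_k\rangle$ of elements of $C$ with $C=\bigcup_{i=1}^k C_{\bar g_i(F(g_i))}$ (coded as a non-constant-zero element of $C$). $\mu$ is Feferman's search operator ($\mu(f)$ = least $n$ with $f(n)=0$ if one exists). $\{e\}(\Theta,\mu,\vec y)=a$ means that the $e$-th Kleene computation (schemes S1–S9, with an extra application scheme: if $F(g)=\{e_1\}(\Theta,\mu,g,\dots)$ is total then $\Theta(F)(a)$ may be computed) with inputs $\Theta,\mu,\vec y$ terminates with output $a$. *)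

theory Defs
  imports Main "HOL-Library.Nat_Bijection" "HOL-Library.Multiset"
begin

type_synonym fun1 = "nat \<Rightarrow> nat"
type_synonym fun2 = "fun1 \<Rightarrow> nat"


subsection \<open>Special fan functionals and the search operator\<close>

definition cantor :: "fun1 set" where
  "cantor = {f. \<forall>n. f n \<in> {0, 1}}"

definition nbhd :: "nat list \<Rightarrow> fun1 set" where
  "nbhd s = {f \<in> cantor. \<forall>i < length s. f i = s ! i}"

definition initseg :: "fun1 \<Rightarrow> nat \<Rightarrow> nat list" where
  "initseg g n = map g [0..<n]"

definition special_fan :: "(fun2 \<Rightarrow> fun1 list) \<Rightarrow> bool" where
  "special_fan \<Theta> \<longleftrightarrow>
     (\<forall>F. set (\<Theta> F) \<subseteq> cantor \<and> cantor = (\<Union>g \<in> set (\<Theta> F). nbhd (initseg g (F g))))"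

text \<open>
  A sequence of length \<open>k > 0\<close> is coded by \<open>k\<close> zeros, a one, and then the interleaving of its
  members; on members of \<^const>\<open>cantor\<close> this is injective and yields elements of \<^const>\<open>cantor\<close>
  that are not constantly zero. The empty sequence is never a value of a special fan functional.
\<close>
definition seq_code :: "fun1 list \<Rightarrow> fun1" where
  "seq_code gs n =
     (let k = length gs in
      if n < k then 0
      else if n = k then 1
      else (gs ! ((n - (k + 1)) mod k)) ((n - (k + 1)) div k))"

definition fan_code :: "(fun2 \<Rightarrow> fun1 list) \<Rightarrow> fun2 \<Rightarrow> fun1" where
  "fan_code \<Theta> F = seq_code (\<Theta> F)"

definition feferman_mu :: fun2 where
  "feferman_mu f = (if \<exists>n. f n = 0 then LEAST n. f n = 0 else 0)"


subsection \<open>Kleene computations\<close>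

text \<open>
  Arguments are tagged by their type; \<open>O3\<close> holds functionals of the type of (coded) fan functionals.
\<close>
datatype kobj =
    O0 nat
  | O1 fun1
  | O2 fun2
  | O3 "fun2 \<Rightarrow> fun1"

text \<open>
  \<open>kleene e \<Phi> a\<close> is \<open>{e}(\<Phi>) = a\<close>. An index is the number coding the list of its scheme number and
  parameters. Scheme 6 permutes arguments, \<open>\<tau>\<close> listing the values of the permutation; scheme 10 is
  the application scheme for functionals \<open>O3\<close>.
\<close>
inductive kleene :: "nat \<Rightarrow> kobj list \<Rightarrow> nat \<Rightarrow> bool" where
  S1: "kleene (list_encode [1]) (O0 x # \<Phi>) (Suc x)"
| S2: "kleene (list_encode [2, q]) \<Phi> q"
| S3: "kleene (list_encode [3]) (O0 x # \<Phi>) x"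
| S4: "kleene d \<Phi> b \<Longrightarrow> kleene c (O0 b # \<Phi>) a \<Longrightarrow> kleene (list_encode [4, c, d]) \<Phi> a"
| S5_zero: "kleene c \<Phi> a \<Longrightarrow> kleene (list_encode [5, c, d]) (O0 0 # \<Phi>) a"
| S5_Suc: "kleene (list_encode [5, c, d]) (O0 x # \<Phi>) b \<Longrightarrow> kleene d (O0 x # O0 b # \<Phi>) a \<Longrightarrow>
    kleene (list_encode [5, c, d]) (O0 (Suc x) # \<Phi>) a"
| S6: "mset \<tau> = mset [0..<length \<Phi>] \<Longrightarrow> kleene d (map (\<lambda>i. \<Phi> ! i) \<tau>) a \<Longrightarrow>
    kleene (list_encode [6, list_encode \<tau>, d]) \<Phi> a"
| S7: "kleene (list_encode [7]) (O1 f # O0 x # \<Phi>) (f x)"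
| S8: "(\<forall>n. kleene d (O2 F # O0 n # \<Phi>) (h n)) \<Longrightarrow>
    kleene (list_encode [8, d]) (O2 F # \<Phi>) (F h)"
| S9: "m \<le> length \<Phi> \<Longrightarrow> kleene c (take m \<Phi>) a \<Longrightarrow>
    kleene (list_encode [9, m]) (O0 c # \<Phi>) a"
| S10: "(\<forall>g. kleene d (O3 T # O1 g # \<Phi>) (F g)) \<Longrightarrow>
    kleene (list_encode [10, d]) (O3 T # O0 x # \<Phi>) (T F x)"


subsection \<open>Sets of numbers definable by a universal function quantifier over an arithmetical formula\<close>

text \<open>
  Formulas of first-order arithmetic with one free function variable, applied by \<open>App\<close>.
\<close>
datatype aterm =
    Var nat
  | Zero
  | Succ aterm
  | Plus aterm aterm
  | Times aterm aterm
  | App aterm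

datatype aform =
    Eq aterm aterm
  | Neg aform
  | Conj aform aform
  | All nat aform

primrec aval :: "fun1 \<Rightarrow> (nat \<Rightarrow> nat) \<Rightarrow> aterm \<Rightarrow> nat" where
  "aval f s (Var i) = s i"
| "aval f s Zero = 0"
| "aval f s (Succ t) = Suc (aval f s t)"
| "aval f s (Plus t u) = aval f s t + aval f s u"
| "aval f s (Times t u) = aval f s t * aval f s u"
| "aval f s (App t) = f (aval f s t)"

primrec asat :: "fun1 \<Rightarrow> (nat \<Rightarrow> nat) \<Rightarrow> aform \<Rightarrow> bool" where
  "asat f s (Eq t u) \<longleftrightarrow> aval f s t = aval f s u"
| "asat f s (Neg \<phi>) \<longleftrightarrow> \<not> asat f s \<phi>"
| "asat f s (Conj \<phi> \<psi>) \<longleftrightarrow> asat f s \<phi> \<and> asat f s \<psi>"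
| "asat f s (All i \<phi>) \<longleftrightarrow> (\<forall>n. asat f (s(i := n)) \<phi>)"

text \<open>
  The number argument is variable 0; any other free variable is read as 0, so it adds nothing.
\<close>
definition Pi11 :: "nat set \<Rightarrow> bool" where
  "Pi11 A \<longleftrightarrow> (\<exists>\<phi>. \<forall>n. n \<in> A \<longleftrightarrow> (\<forall>f. asat f ((\<lambda>_. 0)(0 := n)) \<phi>))"

fun triple_code :: "nat \<times> nat list \<times> nat \<Rightarrow> nat" where
  "triple_code (e, ys, a) = prod_encode (e, prod_encode (list_encode ys, a))"

end

theory Submission
  imports Defs "HOL-Library.Countable_Set"
begin

text \<open>
  The complement of the set is shown to be \<open>\<Sigma>\<^sup>1\<^sub>1\<close> by a Loewenheim-Skolem argument. If a
  computation fails to have value \<open>a\<close> for some \<open>\<Theta>\<close>, close a countable set of functions under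
  witnesses of the non-totality of functionals computable with parameters from the set, under the
  members of \<open>\<Theta>(F)\<close> for the total ones, and under arguments separating two of them. The
  computations with parameters in this set form a countable object: a single-valued relation closed
  under the Kleene schemes, with scheme 10 relativised to the countable set. Conversely, from any
  such object, minimal or not, one recovers a special fan functional: use the values prescribed for
  the functionals that it represents, and compactness of Cantor space for all others. By induction,
  every true computation then belongs to the relation, so that a computation missing from it fails.
  Being such an object is an arithmetical condition.
\<close>

section \<open>Kleene computations are single-valued\<close>

lemma kleene_S8_cases:
  assumes "kleene (list_encode [8, d]) (O2 F # \<Phi>) b"
  obtains h where "\<forall>n. kleene d (O2 F # O0 n # \<Phi>) (h n)" "b = F h"
  using assms by (cases rule: kleene.cases) (auto simp: list_encode_eq simp del: list_encode.simps)

lemma kleene_S10_cases: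
  assumes "kleene (list_encode [10, d]) (O3 T # O0 x # \<Phi>) b"
  obtains F where "\<forall>g. kleene d (O3 T # O1 g # \<Phi>) (F g)" "b = T F x"
  using assms by (cases rule: kleene.cases) (auto simp: list_encode_eq simp del: list_encode.simps)

text \<open>
  The quantifier over \<open>b\<close> stays inside the formula: otherwise the conclusion of case \<open>S10\<close> is just
  \<open>T F x = b\<close>, and matching it is an ambiguous higher-order unification problem.
\<close>
lemma kleene_unique_all: "kleene e \<Phi> a \<Longrightarrow> \<forall>b. kleene e \<Phi> b \<longrightarrow> a = b"
proof (induction rule: kleene.induct)
  case (S1 x \<Phi>)
  show ?case
    by (intro allI impI, erule kleene.cases)
      (auto simp: list_encode_eq simp del: list_encode.simps)
next
  case (S2 q \<Phi>)
  show ?case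
    by (intro allI impI, erule kleene.cases)
      (auto simp: list_encode_eq simp del: list_encode.simps)
next
  case (S3 x \<Phi>)
  show ?case
    by (intro allI impI, erule kleene.cases)
      (auto simp: list_encode_eq simp del: list_encode.simps)
next
  case (S4 d \<Phi> c0 c a)
  show ?case
    by (intro allI impI, erule kleene.cases)
      (auto dest!: S4.IH[rule_format] simp: list_encode_eq simp del: list_encode.simps)
next
  case (S5_zero c \<Phi> a d)
  show ?case
    by (intro allI impI, erule kleene.cases)
      (auto dest!: S5_zero.IH[rule_format] simp: list_encode_eq simp del: list_encode.simps)
next
  case (S5_Suc c d x \<Phi> b0 a)
  show ?case
    by (intro allI impI, erule kleene.cases)
      (auto dest!: S5_Suc.IH[rule_format] simp: list_encode_eq simp del: list_encode.simps)
next
  case (S6 \<tau> \<Phi> d a)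
  show ?case
    by (intro allI impI, erule kleene.cases)
      (auto dest!: S6.IH[rule_format] simp: list_encode_eq simp del: list_encode.simps)
next
  case (S7 f x \<Phi>)
  show ?case
    by (intro allI impI, erule kleene.cases)
      (auto simp: list_encode_eq simp del: list_encode.simps)
next
  case (S8 d F \<Phi> h)
  show ?case
  proof (intro allI impI)
    fix b assume b: "kleene (list_encode [8, d]) (O2 F # \<Phi>) b"
    obtain h' where h': "\<forall>n. kleene d (O2 F # O0 n # \<Phi>) (h' n)" "b = F h'"
      using b by (rule kleene_S8_cases)
    have "h n = h' n" for n
      using S8.IH[THEN spec[of _ n]] h'(1)[THEN spec[of _ n]] by simp
    then have "h = h'" by blast
    with h'(2) show "F h = b" by (simp only:)
  qed
next
  case (S9 m \<Phi> c a)
  show ?case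
    by (intro allI impI, erule kleene.cases)
      (auto dest!: S9.IH[rule_format] simp: list_encode_eq simp del: list_encode.simps)
next
  case (S10 d T \<Phi> F x)
  show ?case
  proof (intro allI impI)
    fix b assume b: "kleene (list_encode [10, d]) (O3 T # O0 x # \<Phi>) b"
    obtain F' where F': "\<forall>g. kleene d (O3 T # O1 g # \<Phi>) (F' g)" "b = T F' x"
      using b by (rule kleene_S10_cases)
    have "F g = F' g" for g
      using S10.IH[THEN spec[of _ g]] F'(1)[THEN spec[of _ g]] by simp
    then have "F = F'" by (rule ext)
    with F'(2) show "T F x = b" by (simp only:)
  qed
qed

lemma kleene_unique: "kleene e \<Phi> a \<Longrightarrow> kleene e \<Phi> b \<Longrightarrow> a = b"
  using kleene_unique_all by blast

section \<open>Compactness of Cantor space\<close>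

text \<open>Koenig's argument: an uncovered neighbourhood has an uncovered half, and following such
  halves gives a branch \<open>h\<close> all of whose initial segments are uncovered. Yet the
  segment of length \<open>F h\<close> is covered by \<open>h\<close> alone.\<close>

lemma ex_finite_cover:
  "\<exists>gs. set gs \<subseteq> cantor \<and> cantor = (\<Union>g \<in> set gs. nbhd (initseg g (F g)))"
proof -
  define covered where
    "covered s \<longleftrightarrow> (\<exists>gs. set gs \<subseteq> cantor \<and> nbhd s \<subseteq> (\<Union>g \<in> set gs. nbhd (initseg g (F g))))" for s
  have split: "covered s" if "covered (s @ [0])" "covered (s @ [1])" for s
  proof -
    obtain gs hs where "set gs \<subseteq> cantor" "set hs \<subseteq> cantor"
      and 0: "nbhd (s @ [0]) \<subseteq> (\<Union>g \<in> set gs. nbhd (initseg g (F g)))"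
      and 1: "nbhd (s @ [1]) \<subseteq> (\<Union>g \<in> set hs. nbhd (initseg g (F g)))"
      using \<open>covered (s @ [0])\<close> \<open>covered (s @ [1])\<close> unfolding covered_def by blast
    moreover have "nbhd s \<subseteq> nbhd (s @ [0]) \<union> nbhd (s @ [1])"
    proof
      fix f assume f: "f \<in> nbhd s"
      then have "f (length s) = 0 \<or> f (length s) = 1"
        by (simp add: nbhd_def cantor_def)
      with f show "f \<in> nbhd (s @ [0]) \<union> nbhd (s @ [1])"
        by (auto simp: nbhd_def nth_append less_Suc_eq)
    qed
    ultimately have "set (gs @ hs) \<subseteq> cantor"
      "nbhd s \<subseteq> (\<Union>g \<in> set (gs @ hs). nbhd (initseg g (F g)))"
      by auto
    then show ?thesis unfolding covered_def by blast
  qed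
  have "covered []"
  proof (rule ccontr)
    assume bad: "\<not> covered []"
    \<comment> \<open>At an uncovered \<open>s\<close>, if the half with bit 0 is covered, then by
      \<open>split\<close> the half with bit 1 is not.\<close>
    define next_bit where "next_bit s = (if covered (s @ [0]) then 1 else 0 :: nat)" for s
    define path where "path = rec_nat [] (\<lambda>_ s. s @ [next_bit s])"
    have path_simps: "path 0 = []" "path (Suc n) = path n @ [next_bit (path n)]" for n
      by (simp_all add: path_def)
    define h where "h n = next_bit (path n)" for n
    have path_h: "path n = initseg h n" for n
      by (induction n) (simp_all add: path_simps initseg_def h_def)
    have "\<not> covered (path n)" for n
    proof (induction n)
      case 0
      then show ?case using bad by (simp add: path_simps)
    next
      case (Suc n)
      then show ?case using split[of "path n"] by (auto simp: path_simps next_bit_def)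
    qed
    moreover have "h \<in> cantor"
      by (simp add: cantor_def h_def next_bit_def)
    then have "covered (initseg h (F h))"
      unfolding covered_def by (intro exI[of _ "[h]"]) simp
    ultimately show False
      by (simp add: path_h)
  qed
  then obtain gs where gs: "set gs \<subseteq> cantor" "nbhd [] \<subseteq> (\<Union>g \<in> set gs. nbhd (initseg g (F g)))"
    unfolding covered_def by blast
  moreover have "nbhd [] = cantor" "nbhd s \<subseteq> cantor" for s
    by (auto simp: nbhd_def)
  ultimately have "cantor = (\<Union>g \<in> set gs. nbhd (initseg g (F g)))"
    by blast
  with gs(1) show ?thesis by blast
qed

section \<open>Countable models\<close>

abbreviation num_code :: "nat \<Rightarrow> nat" where
  "num_code n \<equiv> prod_encode (0, n)"

abbreviation fun_code :: "nat \<Rightarrow> nat" where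
  "fun_code i \<equiv> prod_encode (1, i)"

abbreviation mu_code :: nat where
  "mu_code \<equiv> prod_encode (2, 0)"

abbreviation theta_code :: nat where
  "theta_code \<equiv> prod_encode (3, 0)"

text \<open>
  \<open>V e xs = Suc a\<close> says that the computation \<open>e\<close> with the coded arguments \<open>xs\<close> has value \<open>a\<close>, and
  \<open>V e xs = 0\<close> that it has none. The type 1 arguments range over the functions \<open>A i\<close> only, and the
  members of \<open>I d xs\<close> are the indices of the functions in the value of the fan functional on the
  functional with index \<open>d\<close> and parameters \<open>xs\<close>. Nothing requires \<open>V\<close> to be the least
  solution, which is what makes the conditions arithmetical.
\<close>
locale fan_model =
  fixes V :: "nat \<Rightarrow> nat list \<Rightarrow> nat" and A :: "nat \<Rightarrow> fun1" and I :: "nat \<Rightarrow> nat list \<Rightarrow> nat list"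
  assumes A_zero: "\<exists>i. A i = (\<lambda>_. 0)"
    and A_update: "\<exists>j. A j = (A i)(n := v)"
    and A_inj: "A i = A j \<Longrightarrow> i = j"
    and V1: "V (list_encode [1]) (num_code x # xs) = Suc (Suc x)"
    and V2: "V (list_encode [2, q]) xs = Suc q"
    and V3: "V (list_encode [3]) (num_code x # xs) = Suc x"
    and V4: "V d xs = Suc b \<Longrightarrow> V c (num_code b # xs) = Suc a \<Longrightarrow> V (list_encode [4, c, d]) xs = Suc a"
    and V5_zero: "V c xs = Suc a \<Longrightarrow> V (list_encode [5, c, d]) (num_code 0 # xs) = Suc a"
    and V5_Suc: "V (list_encode [5, c, d]) (num_code x # xs) = Suc b \<Longrightarrow>
      V d (num_code x # num_code b # xs) = Suc a \<Longrightarrow>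
      V (list_encode [5, c, d]) (num_code (Suc x) # xs) = Suc a"
    and V6: "mset \<tau> = mset [0..<length xs] \<Longrightarrow> V d (map (\<lambda>i. xs ! i) \<tau>) = Suc a \<Longrightarrow>
      V (list_encode [6, list_encode \<tau>, d]) xs = Suc a"
    and V7: "V (list_encode [7]) (fun_code i # num_code x # xs) = Suc (A i x)"
    and V8: "(\<And>n. V d (mu_code # num_code n # xs) = Suc (h n)) \<Longrightarrow>
      V (list_encode [8, d]) (mu_code # xs) = Suc (feferman_mu h)"
    and V9: "m \<le> length xs \<Longrightarrow> V c (take m xs) = Suc a \<Longrightarrow>
      V (list_encode [9, m]) (num_code c # xs) = Suc a"
    and V10: "(\<And>i. V d (theta_code # fun_code i # xs) = Suc (G i)) \<Longrightarrow> I d xs \<noteq> [] \<Longrightarrow>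
      V (list_encode [10, d]) (theta_code # num_code x # xs) = Suc (seq_code (map A (I d xs)) x)"
    and I_cantor: "(\<And>i. V d (theta_code # fun_code i # xs) = Suc (G i)) \<Longrightarrow> j \<in> set (I d xs) \<Longrightarrow>
      A j \<in> cantor"
    and I_cover: "(\<And>i. V d (theta_code # fun_code i # xs) = Suc (G i)) \<Longrightarrow> A i \<in> cantor \<Longrightarrow>
      \<exists>j \<in> set (I d xs). \<forall>m < G j. A i m = A j m"
    and I_extensional: "(\<And>i. V d (theta_code # fun_code i # xs) = Suc (G i)) \<Longrightarrow>
      (\<And>i. V d' (theta_code # fun_code i # xs') = Suc (G i)) \<Longrightarrow> I d xs = I d' xs'"
begin

section \<open>A special fan functional obtained from a countable model\<close>

lemma ex_A_cantor: "\<exists>i. A i \<in> cantor"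
proof -
  obtain i where "A i = (\<lambda>_. 0)" using A_zero by blast
  then have "A i \<in> cantor" by (simp add: cantor_def)
  then show ?thesis by blast
qed

text \<open>Closure under one-point changes makes the functions \<open>A i\<close> dense in Cantor
  space: starting from any binary \<open>A i\<close>, one value after another is corrected.\<close>

lemma ex_A_approx:
  assumes "h \<in> cantor"
  shows "\<exists>i. A i \<in> cantor \<and> (\<forall>m<n. A i m = h m)"
proof (induction n)
  case 0
  then show ?case using ex_A_cantor by auto
next
  case (Suc n)
  then obtain i where "A i \<in> cantor" "\<forall>m<n. A i m = h m" by blast
  moreover obtain j where "A j = (A i)(n := h n)" using A_update by blast
  moreover have "(A i)(n := h n) \<in> cantor"
    using assms \<open>A i \<in> cantor\<close> by (simp add: cantor_def)
  ultimately have "A j \<in> cantor \<and> (\<forall>m<Suc n. A j m = h m)"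
    by (simp add: less_Suc_eq)
  then show ?case by blast
qed

definition represents :: "nat \<Rightarrow> nat list \<Rightarrow> fun2 \<Rightarrow> bool" where
  "represents d xs F \<longleftrightarrow> (\<forall>i. V d (theta_code # fun_code i # xs) = Suc (F (A i)))"

text \<open>\<open>I_cover\<close> speaks of the functions \<open>A i\<close> only, but finitely
  many centres have bounded radii, so density carries the cover to all of Cantor space.\<close>

lemma represents_cover:
  assumes "represents d xs F"
  shows "set (map A (I d xs)) \<subseteq> cantor"
    and "cantor = (\<Union>g \<in> set (map A (I d xs)). nbhd (initseg g (F g)))"
proof -
  note rep = assms[unfolded represents_def, rule_format]
  show "set (map A (I d xs)) \<subseteq> cantor"
    using I_cantor[OF rep] by auto
  show "cantor = (\<Union>g \<in> set (map A (I d xs)). nbhd (initseg g (F g)))"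
  proof (intro equalityI subsetI)
    fix h assume h: "h \<in> cantor"
    \<comment> \<open>The sum bounds every radius, so an \<open>A i\<close> agreeing with
      \<open>h\<close> below \<open>n\<close> lies in the same neighbourhoods of the cover as
      \<open>h\<close>.\<close>
    define n where "n = sum_list (map (F \<circ> A) (I d xs))"
    obtain i where i: "A i \<in> cantor" "\<forall>m<n. A i m = h m"
      using ex_A_approx[OF h] by blast
    obtain j where j: "j \<in> set (I d xs)" "\<forall>m < F (A j). A i m = A j m"
      using I_cover[OF rep i(1)] by blast
    have "F (A j) \<le> n"
      unfolding n_def using j(1) member_le_sum_list[of "F (A j)" "map (F \<circ> A) (I d xs)"] by auto
    then have "h \<in> nbhd (initseg (A j) (F (A j)))"
      using h i j by (auto simp: nbhd_def initseg_def)
    then show "h \<in> (\<Union>g \<in> set (map A (I d xs)). nbhd (initseg g (F g)))"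
      using j(1) by auto
  qed (auto simp: nbhd_def)
qed

text \<open>The choice is made among index lists and depends on \<open>F\<close> alone, as the value
  of a functional must. Compactness supplies a value where no pair represents
  \<open>F\<close>.\<close>

definition theta :: "fun2 \<Rightarrow> fun1 list" where
  "theta F =
     (if \<exists>d xs. represents d xs F then map A (SOME is. \<exists>d xs. represents d xs F \<and> is = I d xs)
      else SOME gs. set gs \<subseteq> cantor \<and> cantor = (\<Union>g \<in> set gs. nbhd (initseg g (F g))))"

text \<open>Two pairs representing \<open>F\<close> have the same values at all \<open>A i\<close>,
  so \<open>I_extensional\<close> leaves a single candidate for the choice.\<close>

lemma theta_eq:
  assumes "represents d xs F"
  shows "theta F = map A (I d xs)"
proof -
  have "I d' xs' = I d xs" if "represents d' xs' F" for d' xs'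
    by (rule I_extensional[of _ _ "\<lambda>i. F (A i)"]) (use assms that in \<open>auto simp: represents_def\<close>)
  then have "(SOME is. \<exists>d xs. represents d xs F \<and> is = I d xs) = I d xs"
    using assms by (intro some_equality) blast+
  moreover have "\<exists>d xs. represents d xs F" using assms by blast
  ultimately show ?thesis
    unfolding theta_def by (simp only: if_True)
qed

lemma special_fan_theta: "special_fan theta"
  unfolding special_fan_def
proof
  fix F
  show "set (theta F) \<subseteq> cantor \<and> cantor = (\<Union>g \<in> set (theta F). nbhd (initseg g (F g)))"
  proof (cases "\<exists>d xs. represents d xs F")
    case True
    then obtain d xs where rep: "represents d xs F" by blast
    show ?thesis
      unfolding theta_eq[OF rep] using represents_cover[OF rep] by blast
  next
    case False
    then have "theta F = (SOME gs. set gs \<subseteq> cantor \<and> cantor = (\<Union>g \<in> set gs. nbhd (initseg g (F g))))"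
      unfolding theta_def by (rule if_not_P)
    then show ?thesis
      using someI_ex[OF ex_finite_cover[of F]] by (simp only:)
  qed
qed

section \<open>Transfer of true computations to the model\<close>

definition args :: "kobj set" where
  "args = range O0 \<union> O1 ` range A \<union> {O2 feferman_mu, O3 (fan_code theta)}"

text \<open>\<open>args\<close> contains one functional of each of the types 2 and 3, so constant
  codes lose no information there.\<close>

primrec obj_code :: "kobj \<Rightarrow> nat" where
  "obj_code (O0 n) = num_code n"
| "obj_code (O1 g) = fun_code (inv A g)"
| "obj_code (O2 F) = mu_code"
| "obj_code (O3 T) = theta_code"

lemma inv_A [simp]: "inv A (A i) = i"
  using A_inj by (simp add: inj_def)

text \<open>Induction over the true computation: each scheme is matched by a closure condition on
  \<open>V\<close>. At scheme 10 the instances of the premise at the functions \<open>A i\<close>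
  show that \<open>F\<close> is represented, so that \<open>theta F\<close> is the list prescribed
  by \<open>I\<close>.\<close>

lemma kleene_imp_V: "kleene e \<Phi> a \<Longrightarrow> set \<Phi> \<subseteq> args \<Longrightarrow> V e (map obj_code \<Phi>) = Suc a"
proof (induction rule: kleene.induct)
  case (S4 d \<Phi> b c a)
  then show ?case using V4[of d _ b c a] by (simp add: args_def)
next
  case (S5_zero c \<Phi> a d)
  then show ?case using V5_zero[of c _ a d] by simp
next
  case (S5_Suc c d x \<Phi> b a)
  then show ?case using V5_Suc[of c d x _ b a] by (simp add: args_def)
next
  case (S6 \<tau> \<Phi> d a)
  have set_\<tau>: "set \<tau> = {0..<length \<Phi>}"
    using mset_eq_setD[OF S6.hyps(1)] by simp
  then have "set (map (\<lambda>i. \<Phi> ! i) \<tau>) \<subseteq> args"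
    using S6.prems by auto
  moreover have "map obj_code (map (\<lambda>i. \<Phi> ! i) \<tau>) = map (\<lambda>i. map obj_code \<Phi> ! i) \<tau>"
    using set_\<tau> by simp
  ultimately have "V d (map (\<lambda>i. map obj_code \<Phi> ! i) \<tau>) = Suc a"
    using S6.IH by metis
  then show ?case
    by (intro V6) (simp_all only: length_map S6.hyps)
next
  case (S7 f x \<Phi>)
  then obtain i where "f = A i" by (auto simp: args_def)
  then show ?case using V7[of i x] by simp
next
  case (S8 d F \<Phi> h)
  then have "F = feferman_mu" by (auto simp: args_def)
  then show ?case using S8 V8[of d _ h] by (simp add: args_def)
next
  case (S9 m \<Phi> c a)
  moreover have "set (take m \<Phi>) \<subseteq> args"
    using S9.prems set_take_subset[of m \<Phi>] by auto
  ultimately show ?case using V9[of m "map obj_code \<Phi>" c a] by (simp add: take_map)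
next
  case (S10 d T \<Phi> F x)
  then have T: "T = fan_code theta" by (auto simp: args_def)
  have rep: "represents d (map obj_code \<Phi>) F"
    unfolding represents_def
  proof
    fix i
    have "set (O3 T # O1 (A i) # \<Phi>) \<subseteq> args"
      using S10.prems by (auto simp: args_def)
    with S10.IH have "V d (map obj_code (O3 T # O1 (A i) # \<Phi>)) = Suc (F (A i))" by blast
    then show "V d (theta_code # fun_code i # map obj_code \<Phi>) = Suc (F (A i))" by simp
  qed
  \<comment> \<open>Cantor space is nonempty, so the empty list does not cover it.\<close>
  have "I d (map obj_code \<Phi>) \<noteq> []"
    using represents_cover(2)[OF rep] ex_A_cantor by auto
  then show ?case
    using V10[of d "map obj_code \<Phi>" "\<lambda>i. F (A i)" x] rep
    by (simp add: represents_def T fan_code_def theta_eq[OF rep])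
qed (use V1 V2 V3 in simp_all)

end

section \<open>Countable submodels\<close>

text \<open>Countably many stages suffice: a finite list over their union already lies in one stage,
  and its set \<open>G xs\<close> is contained in the next.\<close>

lemma countable_closure:
  fixes G :: "'a list \<Rightarrow> 'a set"
  assumes "\<And>xs. countable (G xs)"
  shows "\<exists>S. countable S \<and> (\<forall>xs. set xs \<subseteq> S \<longrightarrow> G xs \<subseteq> S)"
proof -
  define S where "S = rec_nat {} (\<lambda>_ X. X \<union> (\<Union>xs \<in> lists X. G xs))"
  have S_simps: "S 0 = {}" "S (Suc n) = S n \<union> (\<Union>xs \<in> lists (S n). G xs)" for n
    by (simp_all add: S_def)
  have "countable (S n)" for n
    by (induction n) (use assms in \<open>auto simp: S_simps intro!: countable_UN\<close>)
  then have "countable (\<Union>n. S n)" by blast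
  moreover have mono: "S m \<subseteq> S n" if "m \<le> n" for m n
    using that by (induction rule: dec_induct) (auto simp: S_simps)
  have fin: "\<exists>n. set xs \<subseteq> S n" if "set xs \<subseteq> (\<Union>n. S n)" for xs
    using that
  proof (induction xs)
    case (Cons x xs)
    then obtain m n where "x \<in> S m" "set xs \<subseteq> S n" by auto
    then have "set (x # xs) \<subseteq> S (max m n)"
      using mono[of m "max m n"] mono[of n "max m n"] by auto
    then show ?case by blast
  qed simp
  have "G xs \<subseteq> (\<Union>n. S n)" if sub: "set xs \<subseteq> (\<Union>n. S n)" for xs
  proof -
    obtain n where "set xs \<subseteq> S n" using fin[OF sub] by blast
    then have "G xs \<subseteq> S (Suc n)" by (auto simp: S_simps)
    then show ?thesis by blast
  qed
  ultimately show ?thesis by blast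
qed

text \<open>In the hull \<open>S\<close>, a functional computed with parameters from
  \<open>S\<close> is total as soon as it is defined on \<open>S\<close>, and two total ones are
  equal as soon as they agree on \<open>S\<close>. Hence the true computations with arguments over
  \<open>S\<close> satisfy the conditions of \<open>fan_model\<close>.\<close>

lemma ex_fan_model:
  assumes fan: "special_fan \<Theta>"
  shows "\<exists>V A I. fan_model V A I \<and> (\<forall>e ys a. V e (theta_code # mu_code # map num_code ys) = Suc a \<longleftrightarrow>
    kleene e (O3 (fan_code \<Theta>) # O2 feferman_mu # map O0 ys) a)"
proof -
  define T where "T = fan_code \<Theta>"
  define args where "args S = range O0 \<union> O1 ` S \<union> {O2 feferman_mu, O3 T}" for S
  define comp where "comp d \<Phi> g b \<longleftrightarrow> kleene d (O3 T # O1 g # \<Phi>) b" for d \<Phi> g b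
  define total where "total d \<Phi> \<longleftrightarrow> (\<forall>g. \<exists>b. comp d \<Phi> g b)" for d \<Phi>
  define val where "val d \<Phi> g = (THE b. comp d \<Phi> g b)" for d \<Phi> g
  \<comment> \<open>A non-total functional contributes one point of undefinedness, a total one the
    functions that \<open>I\<close> will have to index.\<close>
  define witness where
    "witness d \<Phi> = (if total d \<Phi> then set (\<Theta> (val d \<Phi>)) else {SOME g. \<nexists>b. comp d \<Phi> g b})" for d \<Phi>
  \<comment> \<open>A point where the two functionals differ; arbitrary if they coincide.\<close>
  define separator where
    "separator d \<Phi> d' \<Phi>' = (SOME g. val d \<Phi> g \<noteq> val d' \<Phi>' g)" for d \<Phi> d' \<Phi>'
  define G where
    "G gs = {\<lambda>_. 0} \<union> (\<Union>g \<in> set gs. \<Union>n. range (\<lambda>v. g(n := v))) \<union>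
       (\<Union>d. \<Union>\<Phi> \<in> lists (args (set gs)). witness d \<Phi>) \<union>
       (\<lambda>(d, \<Phi>, d', \<Phi>'). separator d \<Phi> d' \<Phi>') ` (UNIV \<times> lists (args (set gs)) \<times> UNIV \<times> lists (args (set gs)))"
    for gs :: "fun1 list"
  have "countable (G gs)" for gs
  proof -
    have "countable (lists (args (set gs)))"
      unfolding args_def by (intro countable_lists countable_Un) (auto intro: countable_finite)
    moreover have "countable (witness d \<Phi>)" for d \<Phi>
      by (auto simp: witness_def intro: countable_finite)
    ultimately show ?thesis
      unfolding G_def by (intro countable_Un countable_UN countable_image countable_SIGMA) (auto intro: countable_finite)
  qed
  then obtain S where "countable S" and closed: "\<And>gs. set gs \<subseteq> S \<Longrightarrow> G gs \<subseteq> S"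
    using countable_closure[of G] by blast
  have S_zero: "(\<lambda>_. 0) \<in> S"
    using closed[of "[]"] by (simp add: G_def)
  have S_update: "g(n := v) \<in> S" if "g \<in> S" for g n v
    using closed[of "[g]"] that by (auto simp: G_def)
  \<comment> \<open>A list of arguments mentions only finitely many functions. Collecting them in
    \<open>gs\<close> turns closure under lists of functions into closure under lists of
    arguments.\<close>
  have finite_support: "\<exists>gs. set gs \<subseteq> S \<and> \<Phi> \<in> lists (args (set gs))" if "\<Phi> \<in> lists (args S)" for \<Phi>
  proof -
    have fin: "finite (O1 -` set \<Phi>)" by (intro finite_vimageI) (auto simp: inj_def)
    obtain gs where gs: "set gs = O1 -` set \<Phi>" using finite_list[OF fin] by (rule exE)
    have "set gs \<subseteq> S"
      unfolding gs using that by (force simp: args_def)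
    moreover have "\<Phi> \<in> lists (args (set gs))"
      unfolding gs in_lists_conv_set
    proof
      fix c assume "c \<in> set \<Phi>"
      moreover have "c \<in> args S" using \<open>c \<in> set \<Phi>\<close> that by auto
      ultimately show "c \<in> args (O1 -` set \<Phi>)" by (cases c) (auto simp: args_def)
    qed
    ultimately have "set gs \<subseteq> S \<and> \<Phi> \<in> lists (args (set gs))" by (rule conjI)
    then show ?thesis by blast
  qed
  have S_witness: "witness d \<Phi> \<subseteq> S" if \<Phi>: "\<Phi> \<in> lists (args S)" for d \<Phi>
  proof -
    obtain gs where "set gs \<subseteq> S" "\<Phi> \<in> lists (args (set gs))"
      using finite_support[OF \<Phi>] by blast
    then show ?thesis
      using closed[of gs] unfolding G_def by blast
  qed
  have S_separator: "separator d \<Phi> d' \<Phi>' \<in> S"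
    if \<Phi>: "\<Phi> \<in> lists (args S)" and \<Phi>': "\<Phi>' \<in> lists (args S)" for d \<Phi> d' \<Phi>'
  proof -
    have "\<Phi> @ \<Phi>' \<in> lists (args S)" using \<Phi> \<Phi>' by simp
    then obtain gs where "set gs \<subseteq> S" and *: "\<Phi> @ \<Phi>' \<in> lists (args (set gs))"
      using finite_support by blast
    have "\<Phi> \<in> lists (args (set gs))" "\<Phi>' \<in> lists (args (set gs))"
      using * by simp_all
    then have "separator d \<Phi> d' \<Phi>' \<in> G gs"
      unfolding G_def by (intro UnI2 image_eqI[of _ _ "(d, \<Phi>, d', \<Phi>')"]) simp_all
    then show ?thesis
      using closed[OF \<open>set gs \<subseteq> S\<close>] by (rule subsetD[rotated])
  qed
  \<comment> \<open>An enumeration by all numbers without repetition needs an infinite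
    \<open>S\<close>; the variants of the zero function at 0 provide this.\<close>
  have "infinite S"
  proof
    assume "finite S"
    moreover have "range (\<lambda>v. (\<lambda>_. 0)(0 := v)) \<subseteq> S"
      using S_update[OF S_zero] by blast
    moreover have "inj (\<lambda>v. (\<lambda>_. 0)(0 := v) :: fun1)"
      by (auto simp: inj_def dest: fun_upd_eqD)
    ultimately show False
      using finite_subset range_inj_infinite by blast
  qed
  define A where "A = from_nat_into S"
  have bij: "bij_betw A UNIV S"
    unfolding A_def using \<open>countable S\<close> \<open>infinite S\<close> by (rule bij_betw_from_nat_into)
  then have A_S: "A i \<in> S" and ex_A: "g \<in> S \<Longrightarrow> \<exists>i. A i = g" and inj_A: "inj A" for i g
    by (auto simp: bij_betw_def)
  \<comment> \<open>Tags beyond 2 all decode to \<open>O3 T\<close>, so that every list of numbers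
    decodes to a list of arguments over \<open>S\<close>.\<close>
  define dec where
    "dec c = (case prod_decode c of (t, v) \<Rightarrow>
       if t = 0 then O0 v else if t = 1 then O1 (A v) else if t = 2 then O2 feferman_mu else O3 T)" for c
  have dec_simps [simp]: "dec (num_code n) = O0 n" "dec (fun_code i) = O1 (A i)"
    "dec mu_code = O2 feferman_mu" "dec theta_code = O3 T" for n i
    by (simp_all add: dec_def)
  have dec_args: "map dec xs \<in> lists (args S)" for xs
    by (auto simp: dec_def args_def A_S split: prod.split)
  \<comment> \<open>Convergence is that of the full type structure, where scheme 10 ranges over all
    functions and not only over \<open>S\<close>.\<close>
  define V where
    "V e xs = (if \<exists>a. kleene e (map dec xs) a then Suc (THE a. kleene e (map dec xs) a) else 0)" for e xs
  have V_iff: "V e xs = Suc a \<longleftrightarrow> kleene e (map dec xs) a" for e xs a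
    unfolding V_def using kleene_unique by (auto intro: the_equality theI)
  define I where "I d xs = map (inv A) (\<Theta> (val d (map dec xs)))" for d xs
  have val_eq: "val d \<Phi> g = b" if "comp d \<Phi> g b" for d \<Phi> g b
    unfolding val_def using that kleene_unique unfolding comp_def by blast
  \<comment> \<open>If the functional were not total, its chosen point of undefinedness would lie in
    \<open>S\<close> and be some \<open>A i\<close>, where a value is given.\<close>
  have tot: "total d (map dec xs)" and val_A: "val d (map dec xs) (A i) = H i"
    if H: "\<And>i. V d (theta_code # fun_code i # xs) = Suc (H i)" for d xs H i
  proof -
    have c: "comp d (map dec xs) (A i) (H i)" for i
      using H[of i] by (simp only: V_iff comp_def list.map dec_simps)
    then show "val d (map dec xs) (A i) = H i" by (rule val_eq)
    show "total d (map dec xs)"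
    proof (rule ccontr)
      assume not_total: "\<not> total d (map dec xs)"
      define g where "g = (SOME g. \<nexists>b. comp d (map dec xs) g b)"
      have "\<exists>g. \<nexists>b. comp d (map dec xs) g b"
        using not_total by (simp add: total_def)
      then have "\<nexists>b. comp d (map dec xs) g b"
        unfolding g_def by (rule someI_ex)
      moreover have "g \<in> S"
        using S_witness[OF dec_args, of d xs] not_total by (simp add: witness_def g_def)
      then obtain i where "A i = g" using ex_A by blast
      ultimately show False using c[of i] by blast
    qed
  qed
  have comp_val: "comp d \<Phi> g (val d \<Phi> g)" if "total d \<Phi>" for d \<Phi> g
    using that val_eq unfolding total_def by metis
  have A_I: "map A (I d xs) = \<Theta> (val d (map dec xs))" if "total d (map dec xs)" for d xs
  proof -
    have "set (\<Theta> (val d (map dec xs))) \<subseteq> range A"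
      using S_witness[OF dec_args, of d xs] that bij by (simp add: witness_def bij_betw_def)
    then show ?thesis
      unfolding I_def by (simp add: map_idI f_inv_into_f subset_iff)
  qed
  have "fan_model V A I"
  proof
    show "\<exists>i. A i = (\<lambda>_. 0)" using ex_A[OF S_zero] .
    show "\<exists>j. A j = (A i)(n := v)" for i n v using ex_A[OF S_update[OF A_S]] .
    show "i = j" if "A i = A j" for i j using that inj_A by (simp add: inj_eq)
    show "V (list_encode [1]) (num_code x # xs) = Suc (Suc x)" for x xs
      unfolding V_iff list.map dec_simps by (rule kleene.S1)
    show "V (list_encode [2, q]) xs = Suc q" for q xs
      unfolding V_iff by (rule kleene.S2)
    show "V (list_encode [3]) (num_code x # xs) = Suc x" for x xs
      unfolding V_iff list.map dec_simps by (rule kleene.S3)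
    show "V (list_encode [4, c, d]) xs = Suc a"
      if "V d xs = Suc b" "V c (num_code b # xs) = Suc a" for d xs b c a
      using that unfolding V_iff list.map dec_simps by (rule kleene.S4)
    show "V (list_encode [5, c, d]) (num_code 0 # xs) = Suc a" if "V c xs = Suc a" for c xs a d
      using that unfolding V_iff list.map dec_simps by (rule kleene.S5_zero)
    show "V (list_encode [5, c, d]) (num_code (Suc x) # xs) = Suc a"
      if "V (list_encode [5, c, d]) (num_code x # xs) = Suc b"
        "V d (num_code x # num_code b # xs) = Suc a" for c d x xs b a
      using that unfolding V_iff list.map dec_simps by (rule kleene.S5_Suc)
    show "V (list_encode [6, list_encode \<tau>, d]) xs = Suc a"
      if \<tau>: "mset \<tau> = mset [0..<length xs]" and V: "V d (map (\<lambda>i. xs ! i) \<tau>) = Suc a" for \<tau> xs d a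
    proof -
      have "set \<tau> = {0..<length xs}" using mset_eq_setD[OF \<tau>] by simp
      then have "map dec (map (\<lambda>i. xs ! i) \<tau>) = map (\<lambda>i. map dec xs ! i) \<tau>" by simp
      then have "kleene d (map (\<lambda>i. map dec xs ! i) \<tau>) a" using V unfolding V_iff by metis
      then show ?thesis
        unfolding V_iff by (intro kleene.S6) (simp_all only: length_map \<tau>)
    qed
    show "V (list_encode [7]) (fun_code i # num_code x # xs) = Suc (A i x)" for i x xs
      unfolding V_iff list.map dec_simps by (rule kleene.S7)
    show "V (list_encode [8, d]) (mu_code # xs) = Suc (feferman_mu h)"
      if "\<And>n. V d (mu_code # num_code n # xs) = Suc (h n)" for d xs h
      using that unfolding V_iff list.map dec_simps by (intro kleene.S8) blast
    show "V (list_encode [9, m]) (num_code c # xs) = Suc a"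
      if "m \<le> length xs" "V c (take m xs) = Suc a" for m xs c a
      using that unfolding V_iff list.map dec_simps by (intro kleene.S9) (simp_all add: take_map)
    show "V (list_encode [10, d]) (theta_code # num_code x # xs) = Suc (seq_code (map A (I d xs)) x)"
      if H: "\<And>i. V d (theta_code # fun_code i # xs) = Suc (H i)" for d xs H x
    proof -
      have "kleene (list_encode [10, d]) (O3 T # O0 x # map dec xs) (T (val d (map dec xs)) x)"
        using comp_val[OF tot[OF H]] unfolding comp_def by (intro kleene.S10) blast
      then show ?thesis
        unfolding V_iff list.map dec_simps A_I[OF tot[OF H]] by (simp add: T_def fan_code_def)
    qed
    show "A j \<in> cantor"
      if H: "\<And>i. V d (theta_code # fun_code i # xs) = Suc (H i)" and j: "j \<in> set (I d xs)" for d xs H j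
    proof -
      have "A j \<in> set (\<Theta> (val d (map dec xs)))"
        using j unfolding A_I[OF tot[OF H], symmetric] by simp
      then show ?thesis using fan unfolding special_fan_def by blast
    qed
    show "\<exists>j \<in> set (I d xs). \<forall>m < H j. A i m = A j m"
      if H: "\<And>i. V d (theta_code # fun_code i # xs) = Suc (H i)" and i: "A i \<in> cantor" for d xs H i
    proof -
      let ?F = "val d (map dec xs)"
      have "A i \<in> (\<Union>g \<in> set (\<Theta> ?F). nbhd (initseg g (?F g)))"
        using fan i unfolding special_fan_def by blast
      then obtain j where j: "j \<in> set (I d xs)" "A i \<in> nbhd (initseg (A j) (?F (A j)))"
        unfolding A_I[OF tot[OF H], symmetric] by auto
      have "\<forall>m < H j. A i m = A j m"
        using j(2) unfolding val_A[OF H] by (simp add: nbhd_def initseg_def)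
      with j(1) show ?thesis by blast
    qed
    show "I d xs = I d' xs'"
      if H: "\<And>i. V d (theta_code # fun_code i # xs) = Suc (H i)"
        and H': "\<And>i. V d' (theta_code # fun_code i # xs') = Suc (H i)" for d xs H d' xs'
    proof -
      \<comment> \<open>A difference anywhere would show at the separator, which is some
        \<open>A i\<close>; but there both values are \<open>H i\<close>.\<close>
      have "val d (map dec xs) = val d' (map dec xs')"
      proof (rule ccontr)
        assume "val d (map dec xs) \<noteq> val d' (map dec xs')"
        then have "\<exists>g. val d (map dec xs) g \<noteq> val d' (map dec xs') g" by blast
        then have "val d (map dec xs) (separator d (map dec xs) d' (map dec xs')) \<noteq>
            val d' (map dec xs') (separator d (map dec xs) d' (map dec xs'))"
          unfolding separator_def by (rule someI_ex)
        then show False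
          using ex_A[OF S_separator[OF dec_args[of xs] dec_args[of xs']], of d d']
            val_A[OF H] val_A[OF H'] by metis
      qed
      then show ?thesis by (simp only: I_def)
    qed
  qed
  moreover have "V e (theta_code # mu_code # map num_code ys) = Suc a \<longleftrightarrow>
      kleene e (O3 (fan_code \<Theta>) # O2 feferman_mu # map O0 ys) a" for e ys a
    by (simp add: V_iff T_def[symmetric] o_def)
  ultimately show ?thesis by blast
qed

section \<open>Arithmetical tables\<close>

text \<open>
  Unlike \<^const>\<open>prod_encode\<close>, which divides by 2, this injection is a term of arithmetic.
\<close>
definition poly_pair :: "nat \<Rightarrow> nat \<Rightarrow> nat" where
  "poly_pair x y = (x + y) * (x + y) + x"

text \<open>The code is at least the square of \<open>x + y\<close> and below the square of its
  successor. So it determines the sum, and then \<open>x\<close>.\<close>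

lemma poly_pair_inject [simp]: "poly_pair x y = poly_pair x' y' \<longleftrightarrow> x = x' \<and> y = y'"
proof
  have sum_le: "x + y \<le> x' + y'" if "poly_pair x y = poly_pair x' y'" for x y x' y'
  proof (rule ccontr)
    assume "\<not> x + y \<le> x' + y'"
    then have "Suc (x' + y') * Suc (x' + y') \<le> (x + y) * (x + y)"
      by (intro mult_le_mono) auto
    then have "poly_pair x' y' < poly_pair x y"
      unfolding poly_pair_def by simp
    with that show False by simp
  qed
  assume eq: "poly_pair x y = poly_pair x' y'"
  then have "x + y = x' + y'"
    using sum_le[OF eq] sum_le[OF eq[symmetric]] by simp
  with eq show "x = x' \<and> y = y'"
    by (simp add: poly_pair_def)
qed simp

text \<open>One function variable must carry a whole model: tables 0 to 3 will hold operations on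
  codes, and tables 4 to 6 will hold \<open>V\<close>, \<open>A\<close> and
  \<open>I\<close>.\<close>

definition tab :: "fun1 \<Rightarrow> nat \<Rightarrow> nat \<Rightarrow> nat \<Rightarrow> nat" where
  "tab f k x y = f (poly_pair k (poly_pair x y))"

lemma ex_tab: "\<exists>f. tab f = t"
proof -
  define c where "c = (\<lambda>(k, x, y). poly_pair k (poly_pair x y))"
  have inj: "inj c" by (auto simp: c_def inj_def)
  have "tab ((\<lambda>(k, x, y). t k x y) \<circ> inv c) k x y = t k x y" for k x y
  proof -
    have "poly_pair k (poly_pair x y) = c (k, x, y)" by (simp add: c_def)
    then show ?thesis using inj by (simp add: tab_def)
  qed
  then show ?thesis by blast
qed

section \<open>Terms and formulas about the tables\<close>

primrec numT :: "nat \<Rightarrow> aterm" where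
  "numT 0 = Zero"
| "numT (Suc k) = Succ (numT k)"

lemma aval_numT [simp]: "aval f s (numT k) = k"
  by (induction k) auto

definition pairT :: "aterm \<Rightarrow> aterm \<Rightarrow> aterm" where
  "pairT t u = Plus (Times (Plus t u) (Plus t u)) t"

definition tabT :: "nat \<Rightarrow> aterm \<Rightarrow> aterm \<Rightarrow> aterm" where
  "tabT k t u = App (pairT (numT k) (pairT t u))"

lemma aval_tabT [simp]: "aval f s (tabT k t u) = tab f k (aval f s t) (aval f s u)"
  by (simp add: tabT_def pairT_def tab_def poly_pair_def)

definition Imp :: "aform \<Rightarrow> aform \<Rightarrow> aform" where
  "Imp \<phi> \<psi> = Neg (Conj \<phi> (Neg \<psi>))"

definition Disj :: "aform \<Rightarrow> aform \<Rightarrow> aform" where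
  "Disj \<phi> \<psi> = Neg (Conj (Neg \<phi>) (Neg \<psi>))"

definition Exi :: "nat \<Rightarrow> aform \<Rightarrow> aform" where
  "Exi i \<phi> = Neg (All i (Neg \<phi>))"

lemma asat_connectives [simp]:
  "asat f s (Imp \<phi> \<psi>) \<longleftrightarrow> (asat f s \<phi> \<longrightarrow> asat f s \<psi>)"
  "asat f s (Disj \<phi> \<psi>) \<longleftrightarrow> asat f s \<phi> \<or> asat f s \<psi>"
  "asat f s (Exi i \<phi>) \<longleftrightarrow> (\<exists>n. asat f (s(i := n)) \<phi>)"
  by (auto simp: Imp_def Disj_def Exi_def)

text \<open>A separate constant for the same quantifier marks variables that are read as list codes.
  As \<open>list_encode\<close> is onto, the simplifier can let them range over lists.\<close>

definition AllL :: "nat \<Rightarrow> aform \<Rightarrow> aform" where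
  "AllL i \<phi> = All i \<phi>"

definition ExL :: "nat \<Rightarrow> aform \<Rightarrow> aform" where
  "ExL i \<phi> = Exi i \<phi>"

lemma all_list_code: "(\<forall>n. P n) \<longleftrightarrow> (\<forall>xs. P (list_encode xs))"
  by (metis list_decode_inverse)

lemma asat_list_quantifiers [simp]:
  "asat f s (AllL i \<phi>) \<longleftrightarrow> (\<forall>xs. asat f (s(i := list_encode xs)) \<phi>)"
  "asat f s (ExL i \<phi>) \<longleftrightarrow> (\<exists>xs. asat f (s(i := list_encode xs)) \<phi>)"
  unfolding AllL_def ExL_def Exi_def
  using all_list_code[of "\<lambda>n. asat f (s(i := n)) \<phi>"] all_list_code[of "\<lambda>n. \<not> asat f (s(i := n)) \<phi>"]
  by simp_all

section \<open>Pairs, order and lists in arithmetic\<close>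

definition coding :: "fun1 \<Rightarrow> bool" where
  "coding f \<longleftrightarrow>
     (\<forall>x y. tab f 0 x y = prod_encode (x, y)) \<and>
     (\<forall>x y. tab f 1 x y = (if x < y then 1 else 0)) \<and>
     (\<forall>xs. tab f 2 (list_encode xs) 0 = length xs) \<and>
     (\<forall>xs i. tab f 3 (list_encode xs) i = (if i < length xs then xs ! i else 0))"

definition consT :: "aterm \<Rightarrow> aterm \<Rightarrow> aterm" where
  "consT t u = Succ (tabT 0 t u)"

definition lessF :: "aterm \<Rightarrow> aterm \<Rightarrow> aform" where
  "lessF t u = Eq (tabT 1 t u) (Succ Zero)"

definition lenT :: "aterm \<Rightarrow> aterm" where
  "lenT t = tabT 2 t Zero"

definition nthT :: "aterm \<Rightarrow> aterm \<Rightarrow> aterm" where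
  "nthT t u = tabT 3 t u"

primrec listT :: "aterm list \<Rightarrow> aterm" where
  "listT [] = Zero"
| "listT (t # ts) = consT t (listT ts)"

lemma coding_simps:
  assumes "coding f"
  shows "tab f 0 x y = prod_encode (x, y)"
    "aval f s (consT t u) = Suc (prod_encode (aval f s t, aval f s u))"
    "asat f s (lessF t u) \<longleftrightarrow> aval f s t < aval f s u"
    "aval f s (lenT t) = length (list_decode (aval f s t))"
    "aval f s (nthT t u) =
       (let xs = list_decode (aval f s t); i = aval f s u in if i < length xs then xs ! i else 0)"
    "aval f s (listT ts) = list_encode (map (aval f s) ts)"
proof -
  have L: "tab f 2 n 0 = length (list_decode n)"
    "tab f 3 n i = (let xs = list_decode n in if i < length xs then xs ! i else 0)" for n i
    using assms by (metis coding_def list_decode_inverse)+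
  show "tab f 0 x y = prod_encode (x, y)" using assms by (simp add: coding_def)
  show *: "aval f s (consT t u) = Suc (prod_encode (aval f s t, aval f s u))" for t u
    using assms by (simp add: coding_def consT_def)
  show "asat f s (lessF t u) \<longleftrightarrow> aval f s t < aval f s u"
    using assms by (simp add: coding_def lessF_def)
  show "aval f s (lenT t) = length (list_decode (aval f s t))"
    by (simp add: lenT_def L)
  show "aval f s (nthT t u) =
       (let xs = list_decode (aval f s t); i = aval f s u in if i < length xs then xs ! i else 0)"
    by (simp add: nthT_def L Let_def)
  show "aval f s (listT ts) = list_encode (map (aval f s) ts)"
    by (induction ts) (simp_all add: *)
qed

text \<open>Doubling removes the division by 2 hidden in \<open>triangle\<close>: the right side is
  twice the Cantor pairing of variables 1 and 2.\<close>

definition pairing_axiom :: aform where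
  "pairing_axiom = All 1 (All 2 (
     Eq (Plus (tabT 0 (Var 1) (Var 2)) (tabT 0 (Var 1) (Var 2)))
        (Plus (Times (Plus (Var 1) (Var 2)) (Succ (Plus (Var 1) (Var 2)))) (Plus (Var 1) (Var 1)))))"

text \<open>Any two numbers have the form \<open>x + k\<close>, \<open>x\<close> or the form
  \<open>x\<close>, \<open>Suc (x + k)\<close>, so the two equations fix the whole table without
  mentioning the order.\<close>

definition less_axiom :: aform where
  "less_axiom = All 1 (All 2 (Conj
     (Eq (tabT 1 (Plus (Var 1) (Var 2)) (Var 1)) Zero)
     (Eq (tabT 1 (Var 1) (Succ (Plus (Var 1) (Var 2)))) (Succ Zero))))"

definition len_axiom :: aform where
  "len_axiom = Conj (Eq (lenT Zero) Zero)
     (All 1 (AllL 2 (Eq (lenT (consT (Var 1) (Var 2))) (Succ (lenT (Var 2))))))"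

definition nth_axiom :: aform where
  "nth_axiom = Conj (All 1 (Eq (nthT Zero (Var 1)) Zero))
     (All 1 (AllL 2 (Conj
       (Eq (nthT (consT (Var 1) (Var 2)) Zero) (Var 1))
       (All 3 (Eq (nthT (consT (Var 1) (Var 2)) (Succ (Var 3))) (nthT (Var 2) (Var 3)))))))"

definition coding_axioms :: aform where
  "coding_axioms = Conj pairing_axiom (Conj less_axiom (Conj len_axiom nth_axiom))"

lemma prod_encode_double:
  "p = prod_encode (x, y) \<longleftrightarrow> p + p = (x + y) * Suc (x + y) + (x + x)"
proof -
  have "2 * triangle n = n * Suc n" for n
    by (induction n) simp_all
  from this[of "x + y"] show ?thesis
    by (simp add: prod_encode_def del: mult_Suc_right) presburger
qed

text \<open>Each axiom fixes its table wherever \<open>coding\<close> speaks of it; the recursions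
  along \<open>consT\<close> determine lengths and entries by list induction.\<close>

lemma asat_coding_axioms: "asat f s coding_axioms \<longleftrightarrow> coding f"
proof
  assume "asat f s coding_axioms"
  then have pairing: "asat f s pairing_axiom" and less: "asat f s less_axiom"
    and len: "asat f s len_axiom" and nth: "asat f s nth_axiom"
    by (auto simp: coding_axioms_def)
  have pe: "tab f 0 x y = prod_encode (x, y)" for x y
    using pairing by (simp add: pairing_axiom_def prod_encode_double)
  have "tab f 1 x y = (if x < y then 1 else 0)" for x y
  proof (cases "x < y")
    case True
    then obtain k where "y = Suc (x + k)" using less_iff_Suc_add by auto
    then show ?thesis using less by (simp add: less_axiom_def)
  next
    case False
    then obtain k where "x = y + k" using le_Suc_ex by force
    then show ?thesis using less by (simp add: less_axiom_def)
  qed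
  moreover have "tab f 2 (list_encode xs) 0 = length xs" for xs
    using len by (induction xs) (simp_all add: len_axiom_def lenT_def consT_def pe)
  moreover have "tab f 3 (list_encode xs) i = (if i < length xs then xs ! i else 0)" for xs i
  proof (induction xs arbitrary: i)
    case Nil
    then show ?case using nth by (simp add: nth_axiom_def nthT_def consT_def pe)
  next
    case (Cons x xs)
    then show ?case
      using nth by (cases i) (simp_all add: nth_axiom_def nthT_def consT_def pe)
  qed
  ultimately show "coding f"
    by (simp add: coding_def pe)
next
  assume c: "coding f"
  have "asat f s pairing_axiom"
    using iffD1[OF prod_encode_double refl] by (simp add: pairing_axiom_def coding_simps(1)[OF c])
  moreover have "asat f s less_axiom"
    using c by (simp add: less_axiom_def coding_def)
  moreover have "asat f s len_axiom" "asat f s nth_axiom"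
    by (simp_all add: len_axiom_def nth_axiom_def coding_simps[OF c] Let_def list_decode.simps)
  ultimately show "asat f s coding_axioms"
    by (simp add: coding_axioms_def)
qed

section \<open>The conditions on a model are arithmetical\<close>

definition objT :: "nat \<Rightarrow> aterm \<Rightarrow> aterm" where
  "objT k t = tabT 0 (numT k) t"

abbreviation muT :: aterm where "muT \<equiv> objT 2 Zero"

abbreviation thetaT :: aterm where "thetaT \<equiv> objT 3 Zero"

definition valT :: "aterm \<Rightarrow> aterm \<Rightarrow> aterm" where
  "valT = tabT 4"

definition funT :: "aterm \<Rightarrow> aterm \<Rightarrow> aterm" where
  "funT = tabT 5"

definition idxT :: "aterm \<Rightarrow> aterm \<Rightarrow> aterm" where
  "idxT = tabT 6"

abbreviation V_of :: "fun1 \<Rightarrow> nat \<Rightarrow> nat list \<Rightarrow> nat" where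
  "V_of f e xs \<equiv> tab f 4 e (list_encode xs)"

abbreviation A_of :: "fun1 \<Rightarrow> nat \<Rightarrow> fun1" where
  "A_of f \<equiv> tab f 5"

abbreviation I_of :: "fun1 \<Rightarrow> nat \<Rightarrow> nat list \<Rightarrow> nat list" where
  "I_of f d xs \<equiv> list_decode (tab f 6 d (list_encode xs))"

definition zero_axiom :: aform where
  "zero_axiom = Exi 1 (All 2 (Eq (funT (Var 1) (Var 2)) Zero))"

definition update_axiom :: aform where
  "update_axiom = All 1 (All 2 (All 3 (Exi 4 (All 5 (Conj
     (Imp (Eq (Var 5) (Var 2)) (Eq (funT (Var 4) (Var 5)) (Var 3)))
     (Imp (Neg (Eq (Var 5) (Var 2))) (Eq (funT (Var 4) (Var 5)) (funT (Var 1) (Var 5)))))))))"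

definition inj_axiom :: aform where
  "inj_axiom = All 1 (All 2 (Imp
     (All 3 (Eq (funT (Var 1) (Var 3)) (funT (Var 2) (Var 3))))
     (Eq (Var 1) (Var 2))))"

definition S1_axiom :: aform where
  "S1_axiom = All 1 (AllL 2
     (Eq (valT (listT [numT 1]) (consT (objT 0 (Var 1)) (Var 2))) (Succ (Succ (Var 1)))))"

definition S2_axiom :: aform where
  "S2_axiom = All 1 (AllL 2 (Eq (valT (listT [numT 2, Var 1]) (Var 2)) (Succ (Var 1))))"

definition S3_axiom :: aform where
  "S3_axiom = All 1 (AllL 2
     (Eq (valT (listT [numT 3]) (consT (objT 0 (Var 1)) (Var 2))) (Succ (Var 1))))"

definition S4_axiom :: aform where
  "S4_axiom = All 1 (AllL 2 (All 3 (All 4 (All 5 (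
     Imp (Eq (valT (Var 1) (Var 2)) (Succ (Var 3)))
     (Imp (Eq (valT (Var 4) (consT (objT 0 (Var 3)) (Var 2))) (Succ (Var 5)))
     (Eq (valT (listT [numT 4, Var 4, Var 1]) (Var 2)) (Succ (Var 5)))))))))"

definition S5_zero_axiom :: aform where
  "S5_zero_axiom = All 1 (AllL 2 (All 3 (All 4 (
     Imp (Eq (valT (Var 1) (Var 2)) (Succ (Var 3)))
     (Eq (valT (listT [numT 5, Var 1, Var 4]) (consT (objT 0 Zero) (Var 2))) (Succ (Var 3)))))))"

definition S5_Suc_axiom :: aform where
  "S5_Suc_axiom = All 1 (All 2 (All 3 (AllL 4 (All 5 (All 6 (
     Imp (Eq (valT (listT [numT 5, Var 1, Var 2]) (consT (objT 0 (Var 3)) (Var 4))) (Succ (Var 5)))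
     (Imp (Eq (valT (Var 2) (consT (objT 0 (Var 3)) (consT (objT 0 (Var 5)) (Var 4)))) (Succ (Var 6)))
     (Eq (valT (listT [numT 5, Var 1, Var 2]) (consT (objT 0 (Succ (Var 3))) (Var 4)))
        (Succ (Var 6))))))))))"

definition S6_axiom :: aform where
  "S6_axiom = AllL 1 (AllL 2 (All 3 (All 4 (AllL 5 (
     Imp (Conj (Eq (lenT (Var 1)) (lenT (Var 2))) (Conj (Eq (lenT (Var 5)) (lenT (Var 2)))
       (Conj (All 6 (Imp (lessF (Var 6) (lenT (Var 2)))
                (Exi 7 (Conj (lessF (Var 7) (lenT (Var 2))) (Eq (nthT (Var 1) (Var 7)) (Var 6))))))
             (All 6 (Imp (lessF (Var 6) (lenT (Var 2)))
                (Eq (nthT (Var 5) (Var 6)) (nthT (Var 2) (nthT (Var 1) (Var 6)))))))))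
     (Imp (Eq (valT (Var 3) (Var 5)) (Succ (Var 4)))
     (Eq (valT (listT [numT 6, Var 1, Var 3]) (Var 2)) (Succ (Var 4)))))))))"

definition S7_axiom :: aform where
  "S7_axiom = All 1 (All 2 (AllL 3
     (Eq (valT (listT [numT 7]) (consT (objT 1 (Var 1)) (consT (objT 0 (Var 2)) (Var 3))))
        (Succ (funT (Var 1) (Var 2))))))"

text \<open>Table values are one above true values, so 0 means no value and 1 means a zero. The
  disjunction is the graph of \<open>feferman_mu\<close>: the least zero, or 0 if there is
  none.\<close>

definition S8_axiom :: aform where
  "S8_axiom = (let v = \<lambda>t. valT (Var 1) (consT muT (consT (objT 0 t) (Var 2))) in
     All 1 (AllL 2 (Imp (All 3 (Neg (Eq (v (Var 3)) Zero)))
       (All 4 (Imp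
         (Disj
           (Conj (Eq (v (Var 4)) (numT 1))
             (All 3 (Imp (lessF (Var 3) (Var 4)) (Neg (Eq (v (Var 3)) (numT 1))))))
           (Conj (Eq (Var 4) Zero) (All 3 (Neg (Eq (v (Var 3)) (numT 1))))))
         (Eq (valT (listT [numT 8, Var 1]) (consT muT (Var 2))) (Succ (Var 4))))))))"

definition S9_axiom :: aform where
  "S9_axiom = All 1 (AllL 2 (All 3 (All 4 (AllL 5 (
     Imp (Conj (Neg (lessF (lenT (Var 2)) (Var 1))) (Conj (Eq (lenT (Var 5)) (Var 1))
       (All 6 (Imp (lessF (Var 6) (Var 1)) (Eq (nthT (Var 5) (Var 6)) (nthT (Var 2) (Var 6)))))))
     (Imp (Eq (valT (Var 3) (Var 5)) (Succ (Var 4)))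
     (Eq (valT (listT [numT 9, Var 1]) (consT (objT 0 (Var 3)) (Var 2))) (Succ (Var 4)))))))))"

text \<open>The functional with index variable 1 and parameters variable 2, at the function with index \<open>t\<close>.\<close>
definition fnalT :: "aterm \<Rightarrow> aterm" where
  "fnalT t = valT (Var 1) (consT thetaT (consT (objT 1 t) (Var 2)))"

definition total_form :: aform where
  "total_form = All 3 (Neg (Eq (fnalT (Var 3)) Zero))"

definition cantor_form :: "aterm \<Rightarrow> aform" where
  "cantor_form t = All 9 (Disj (Eq (funT t (Var 9)) Zero) (Eq (funT t (Var 9)) (numT 1)))"

text \<open>The three clauses give the initial zeros, the marker and the interleaving of
  \<open>seq_code\<close>, each value raised by one. Writing a position as quotient times length
  plus remainder avoids division in the formula.\<close>

definition S10_axiom :: aform where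
  "S10_axiom = (let I = idxT (Var 1) (Var 2);
       v = \<lambda>t. valT (listT [numT 10, Var 1]) (consT thetaT (consT (objT 0 t) (Var 2))) in
     All 1 (AllL 2 (Imp total_form (Imp (Neg (Eq (lenT I) Zero)) (Conj
       (All 3 (Imp (lessF (Var 3) (lenT I)) (Eq (v (Var 3)) (numT 1))))
       (Conj (Eq (v (lenT I)) (numT 2))
       (All 3 (Imp (lessF (Var 3) (lenT I)) (All 4
         (Eq (v (Plus (Succ (lenT I)) (Plus (Times (Var 4) (lenT I)) (Var 3))))
            (Succ (funT (nthT I (Var 3)) (Var 4)))))))))))))"

definition I_cantor_axiom :: aform where
  "I_cantor_axiom = (let I = idxT (Var 1) (Var 2) in
     All 1 (AllL 2 (Imp total_form
       (All 4 (Imp (lessF (Var 4) (lenT I)) (cantor_form (nthT I (Var 4))))))))"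

text \<open>\<open>H j\<close> is one less than the table value, so \<open>m < H j\<close> becomes a
  comparison of \<open>Suc m\<close> with that value.\<close>

definition I_cover_axiom :: aform where
  "I_cover_axiom = (let I = idxT (Var 1) (Var 2) in
     All 1 (AllL 2 (Imp total_form (All 3 (Imp (cantor_form (Var 3))
       (Exi 4 (Conj (lessF (Var 4) (lenT I))
         (All 5 (Imp (lessF (Succ (Var 5)) (fnalT (nthT I (Var 4))))
           (Eq (funT (Var 3) (Var 5)) (funT (nthT I (Var 4)) (Var 5))))))))))))"

definition I_extensional_axiom :: aform where
  "I_extensional_axiom = All 1 (AllL 2 (All 4 (AllL 5 (Imp total_form
     (Imp (All 3 (Eq (fnalT (Var 3)) (valT (Var 4) (consT thetaT (consT (objT 1 (Var 3)) (Var 5))))))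
       (Eq (idxT (Var 1) (Var 2)) (idxT (Var 4) (Var 5))))))))"

text \<open>A list with as many entries as there are indices, hitting each index, is a permutation
  by counting. The default 0 is that of table 3, so the left side is what \<open>S6_axiom\<close>
  says once simplified.\<close>

lemma permutation_iff:
  fixes xs ys :: "nat list"
  shows "length \<tau> = length xs \<and> length ys = length xs \<and>
     (\<forall>v<length xs. \<exists>i<length xs. (if i < length \<tau> then \<tau> ! i else 0) = v) \<and>
     (\<forall>i<length xs. (if i < length ys then ys ! i else 0) =
        (if (if i < length \<tau> then \<tau> ! i else 0) < length xs
         then xs ! (if i < length \<tau> then \<tau> ! i else 0) else 0)) \<longleftrightarrow>
   mset \<tau> = mset [0..<length xs] \<and> ys = map (\<lambda>i. xs ! i) \<tau>" (is "?L \<longleftrightarrow> ?R")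
proof
  assume L: ?L
  then have "{0..<length xs} \<subseteq> set \<tau>"
    by (force simp: in_set_conv_nth)
  moreover have "card (set \<tau>) \<le> length xs" using L card_length[of \<tau>] by simp
  ultimately have set_\<tau>: "set \<tau> = {0..<length xs}"
    by (metis card_atLeastLessThan card_seteq List.finite_set diff_zero)
  then have "distinct \<tau>" using L by (simp add: card_distinct)
  then have "mset \<tau> = mset [0..<length xs]"
    using set_\<tau> mset_set_set[of \<tau>] by simp
  moreover have "\<tau> ! i < length xs" if "i < length xs" for i
    using that L set_\<tau> nth_mem[of i \<tau>] by auto
  then have "ys = map (\<lambda>i. xs ! i) \<tau>"
    using L by (auto intro!: nth_equalityI)
  ultimately show ?R by blast
next
  assume R: ?R
  then have len: "length \<tau> = length xs" and set_\<tau>: "set \<tau> = {0..<length xs}"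
    using mset_eq_length[of \<tau> "[0..<length xs]"] mset_eq_setD[of \<tau> "[0..<length xs]"] by auto
  moreover have "\<tau> ! i < length xs" if "i < length xs" for i
    using that len set_\<tau> nth_mem[of i \<tau>] by auto
  moreover have "\<exists>i<length xs. (if i < length \<tau> then \<tau> ! i else 0) = v" if "v < length xs" for v
  proof -
    have "v \<in> set \<tau>" using that set_\<tau> by simp
    then show ?thesis unfolding in_set_conv_nth using len by auto
  qed
  ultimately show ?L using R by simp
qed

lemma feferman_mu_iff:
  "feferman_mu h = c \<longleftrightarrow> h c = 0 \<and> (\<forall>m<c. h m \<noteq> 0) \<or> c = 0 \<and> (\<forall>n. h n \<noteq> 0)"
proof (cases "\<exists>n. h n = 0")
  case True
  then have "(LEAST n. h n = 0) = c \<longleftrightarrow> h c = 0 \<and> (\<forall>m<c. h m \<noteq> 0)"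
    by (metis (mono_tags, lifting) LeastI Least_le leD not_less_Least linorder_neqE_nat)
  moreover have "\<not> (\<forall>n. h n \<noteq> 0)" using True by blast
  ultimately show ?thesis by (simp only: feferman_mu_def True if_True simp_thms)
next
  case False
  then have nz: "h n \<noteq> 0" for n by simp
  from False show ?thesis by (auto simp: feferman_mu_def nz)
qed

text \<open>Removes the quantifier over functions that totality introduces: \<open>h\<close> exists
  exactly when \<open>v\<close> is never 0, and is then its predecessor.\<close>

lemma all_pred_iff:
  "(\<forall>h. (\<forall>n. v n = Suc (h n)) \<longrightarrow> P h) \<longleftrightarrow> ((\<forall>n. v n \<noteq> 0) \<longrightarrow> P (\<lambda>n. v n - 1))"
proof -
  have "(\<forall>n. v n = Suc (h n)) \<longleftrightarrow> (\<forall>n. v n \<noteq> 0) \<and> h = (\<lambda>n. v n - 1)" for h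
    by (auto simp: fun_eq_iff)
  then show ?thesis by simp
qed

lemma seq_code_iff:
  assumes "gs \<noteq> []"
  shows "(\<forall>x. v x = Suc (seq_code gs x)) \<longleftrightarrow>
    (\<forall>x<length gs. v x = 1) \<and> v (length gs) = 2 \<and>
    (\<forall>r<length gs. \<forall>q. v (Suc (length gs) + (q * length gs + r)) = Suc ((gs ! r) q))" (is "?L \<longleftrightarrow> ?R")
proof
  assume ?L
  then show ?R using assms by (simp add: seq_code_def Let_def)
next
  assume R: ?R
  show ?L
  proof
    fix x
    consider "x < length gs" | "x = length gs" | "x > length gs" by linarith
    then show "v x = Suc (seq_code gs x)"
    proof cases
      case 3
      define y where "y = x - (length gs + 1)"
      have x: "x = Suc (length gs) + (y div length gs * length gs + y mod length gs)"
        using 3 by (simp add: y_def)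
      have "y mod length gs < length gs" using assms by simp
      with R have "v x = Suc ((gs ! (y mod length gs)) (y div length gs))"
        by (subst x) blast
      then show ?thesis using 3 by (simp add: seq_code_def y_def Let_def)
    qed (use R in \<open>simp_all add: seq_code_def\<close>)
  qed
qed

section \<open>Meaning of the formulas over correct coding tables\<close>

context
  fixes f :: fun1 and s :: "nat \<Rightarrow> nat"
  assumes coding: "coding f"
begin

lemma objT_simp: "aval f s' (objT k t) = prod_encode (k, aval f s' t)"
  by (simp add: objT_def coding_simps[OF coding])

lemmas form_simps = coding_simps[OF coding] objT_simp valT_def funT_def idxT_def fnalT_def Let_def

lemma asat_zero_axiom: "asat f s zero_axiom \<longleftrightarrow> (\<exists>i. A_of f i = (\<lambda>_. 0))"
  by (simp add: zero_axiom_def form_simps fun_eq_iff)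

lemma asat_update_axiom: "asat f s update_axiom \<longleftrightarrow> (\<forall>i n v. \<exists>j. A_of f j = (A_of f i)(n := v))"
  by (simp add: update_axiom_def form_simps fun_eq_iff)

lemma asat_inj_axiom: "asat f s inj_axiom \<longleftrightarrow> (\<forall>i j. A_of f i = A_of f j \<longrightarrow> i = j)"
  by (simp add: inj_axiom_def form_simps fun_eq_iff)

lemma asat_S1_axiom:
  "asat f s S1_axiom \<longleftrightarrow> (\<forall>x xs. V_of f (list_encode [1]) (num_code x # xs) = Suc (Suc x))"
  by (simp add: S1_axiom_def form_simps)

lemma asat_S2_axiom: "asat f s S2_axiom \<longleftrightarrow> (\<forall>q xs. V_of f (list_encode [2, q]) xs = Suc q)"
  by (simp add: S2_axiom_def form_simps)

lemma asat_S3_axiom: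
  "asat f s S3_axiom \<longleftrightarrow> (\<forall>x xs. V_of f (list_encode [3]) (num_code x # xs) = Suc x)"
  by (simp add: S3_axiom_def form_simps)

lemma asat_S4_axiom:
  "asat f s S4_axiom \<longleftrightarrow> (\<forall>d xs b c a. V_of f d xs = Suc b \<longrightarrow> V_of f c (num_code b # xs) = Suc a \<longrightarrow>
     V_of f (list_encode [4, c, d]) xs = Suc a)"
  by (simp add: S4_axiom_def form_simps)

lemma asat_S5_zero_axiom:
  "asat f s S5_zero_axiom \<longleftrightarrow> (\<forall>c xs a d. V_of f c xs = Suc a \<longrightarrow>
     V_of f (list_encode [5, c, d]) (num_code 0 # xs) = Suc a)"
  by (simp add: S5_zero_axiom_def form_simps)

lemma asat_S5_Suc_axiom:
  "asat f s S5_Suc_axiom \<longleftrightarrow> (\<forall>c d x xs b a.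
     V_of f (list_encode [5, c, d]) (num_code x # xs) = Suc b \<longrightarrow>
     V_of f d (num_code x # num_code b # xs) = Suc a \<longrightarrow>
     V_of f (list_encode [5, c, d]) (num_code (Suc x) # xs) = Suc a)"
  by (simp add: S5_Suc_axiom_def form_simps)

lemma asat_S6_axiom:
  "asat f s S6_axiom \<longleftrightarrow> (\<forall>\<tau> xs d a. mset \<tau> = mset [0..<length xs] \<longrightarrow>
     V_of f d (map (\<lambda>i. xs ! i) \<tau>) = Suc a \<longrightarrow> V_of f (list_encode [6, list_encode \<tau>, d]) xs = Suc a)"
proof -
  have "asat f s S6_axiom \<longleftrightarrow> (\<forall>\<tau> xs d a ys.
     mset \<tau> = mset [0..<length xs] \<and> ys = map (\<lambda>i. xs ! i) \<tau> \<longrightarrow>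
     V_of f d ys = Suc a \<longrightarrow> V_of f (list_encode [6, list_encode \<tau>, d]) xs = Suc a)"
    unfolding permutation_iff[symmetric] by (simp add: S6_axiom_def form_simps)
  then show ?thesis by (simp del: mset_upt)
qed

lemma asat_S7_axiom:
  "asat f s S7_axiom \<longleftrightarrow>
    (\<forall>i x xs. V_of f (list_encode [7]) (fun_code i # num_code x # xs) = Suc (A_of f i x))"
  by (simp add: S7_axiom_def form_simps)

lemma asat_S8_axiom:
  "asat f s S8_axiom \<longleftrightarrow> (\<forall>d xs h. (\<forall>n. V_of f d (mu_code # num_code n # xs) = Suc (h n)) \<longrightarrow>
     V_of f (list_encode [8, d]) (mu_code # xs) = Suc (feferman_mu h))"
proof -
  \<comment> \<open>Exactly one \<open>c\<close> satisfies the graph of \<open>feferman_mu\<close>,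
    so a universal statement about such \<open>c\<close> is a statement about the value.\<close>
  have mu: "(\<forall>c. (v c = 1 \<and> (\<forall>m<c. v m \<noteq> 1)) \<or> (c = 0 \<and> (\<forall>n. v n \<noteq> 1)) \<longrightarrow> P c) \<longleftrightarrow>
      P (feferman_mu (\<lambda>n. v n - 1))" if v: "\<forall>n. v n \<noteq> 0" for v P
  proof -
    have "v n = 1 \<longleftrightarrow> v n - 1 = 0" for n using v[rule_format, of n] by auto
    then have "v c = 1 \<and> (\<forall>m<c. v m \<noteq> 1) \<or> c = 0 \<and> (\<forall>n. v n \<noteq> 1) \<longleftrightarrow>
        feferman_mu (\<lambda>n. v n - 1) = c" for c
      unfolding feferman_mu_iff by (simp only:)
    then show ?thesis by (simp only: simp_thms)
  qed
  let ?v = "\<lambda>d xs n. V_of f d (mu_code # num_code n # xs)"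
  have "asat f s S8_axiom \<longleftrightarrow> (\<forall>d xs. (\<forall>n. ?v d xs n \<noteq> 0) \<longrightarrow>
     (\<forall>c. (?v d xs c = 1 \<and> (\<forall>m<c. ?v d xs m \<noteq> 1)) \<or> (c = 0 \<and> (\<forall>n. ?v d xs n \<noteq> 1)) \<longrightarrow>
       V_of f (list_encode [8, d]) (mu_code # xs) = Suc c))"
    by (simp add: S8_axiom_def form_simps)
  also have "\<dots> \<longleftrightarrow> (\<forall>d xs. (\<forall>n. ?v d xs n \<noteq> 0) \<longrightarrow>
     V_of f (list_encode [8, d]) (mu_code # xs) = Suc (feferman_mu (\<lambda>n. ?v d xs n - 1)))"
    by (intro all_cong1 imp_cong refl mu)
  finally show ?thesis
    unfolding all_pred_iff .
qed

lemma asat_S9_axiom: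
  "asat f s S9_axiom \<longleftrightarrow> (\<forall>m xs c a. m \<le> length xs \<longrightarrow> V_of f c (take m xs) = Suc a \<longrightarrow>
     V_of f (list_encode [9, m]) (num_code c # xs) = Suc a)"
proof -
  have take: "\<not> length xs < m \<and> length ys = m \<and> (\<forall>i<m. (if i < length ys then ys ! i else 0) =
      (if i < length xs then xs ! i else 0)) \<longleftrightarrow> m \<le> length xs \<and> ys = take m xs" for m and xs ys :: "nat list"
    by (auto intro!: nth_equalityI)
  have "asat f s S9_axiom \<longleftrightarrow> (\<forall>m xs c a ys. m \<le> length xs \<and> ys = take m xs \<longrightarrow>
     V_of f c ys = Suc a \<longrightarrow> V_of f (list_encode [9, m]) (num_code c # xs) = Suc a)"
    unfolding take[symmetric] by (simp add: S9_axiom_def form_simps)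
  then show ?thesis by simp
qed

lemma asat_total_form:
  "asat f s' total_form \<longleftrightarrow>
    (\<forall>i. V_of f (s' 1) (theta_code # fun_code i # list_decode (s' 2)) \<noteq> 0)"
  by (simp add: total_form_def form_simps)

lemma asat_cantor_form:
  assumes "\<And>n. aval f (s'(9 := n)) t = aval f s' t"
  shows "asat f s' (cantor_form t) \<longleftrightarrow> A_of f (aval f s' t) \<in> cantor"
  by (simp add: cantor_form_def form_simps assms cantor_def)

lemma asat_S10_axiom:
  "asat f s S10_axiom \<longleftrightarrow> (\<forall>d xs H x. (\<forall>i. V_of f d (theta_code # fun_code i # xs) = Suc (H i)) \<longrightarrow>
     I_of f d xs \<noteq> [] \<longrightarrow> V_of f (list_encode [10, d]) (theta_code # num_code x # xs) =
       Suc (seq_code (map (A_of f) (I_of f d xs)) x))"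
proof -
  have "asat f s S10_axiom \<longleftrightarrow> (\<forall>d xs H. (\<forall>i. V_of f d (theta_code # fun_code i # xs) = Suc (H i)) \<longrightarrow>
     I_of f d xs \<noteq> [] \<longrightarrow> (\<forall>x. V_of f (list_encode [10, d]) (theta_code # num_code x # xs) =
       Suc (seq_code (map (A_of f) (I_of f d xs)) x)))"
    unfolding all_pred_iff
    by (simp add: S10_axiom_def asat_total_form form_simps seq_code_iff numeral_2_eq_2)
  then show ?thesis by blast
qed

lemma asat_I_cantor_axiom:
  "asat f s I_cantor_axiom \<longleftrightarrow> (\<forall>d xs H j. (\<forall>i. V_of f d (theta_code # fun_code i # xs) = Suc (H i)) \<longrightarrow>
     j \<in> set (I_of f d xs) \<longrightarrow> A_of f j \<in> cantor)"
proof -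
  have "asat f s I_cantor_axiom \<longleftrightarrow> (\<forall>d xs H. (\<forall>i. V_of f d (theta_code # fun_code i # xs) = Suc (H i)) \<longrightarrow>
     (\<forall>j \<in> set (I_of f d xs). A_of f j \<in> cantor))"
    unfolding all_pred_iff
    by (simp add: I_cantor_axiom_def asat_total_form asat_cantor_form form_simps all_set_conv_all_nth)
  then show ?thesis by blast
qed

lemma asat_I_cover_axiom:
  "asat f s I_cover_axiom \<longleftrightarrow> (\<forall>d xs H i. (\<forall>i. V_of f d (theta_code # fun_code i # xs) = Suc (H i)) \<longrightarrow>
     A_of f i \<in> cantor \<longrightarrow> (\<exists>j \<in> set (I_of f d xs). \<forall>m < H j. A_of f i m = A_of f j m))"
proof -
  have bex: "(\<exists>j \<in> set js. P j) \<longleftrightarrow> (\<exists>k<length js. P (js ! k))" for js :: "nat list" and P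
    by (metis in_set_conv_nth)
  have less: "m < v - 1 \<longleftrightarrow> Suc m < v" for m v :: nat by auto
  have "asat f s I_cover_axiom \<longleftrightarrow> (\<forall>d xs H. (\<forall>i. V_of f d (theta_code # fun_code i # xs) = Suc (H i)) \<longrightarrow>
     (\<forall>i. A_of f i \<in> cantor \<longrightarrow> (\<exists>j \<in> set (I_of f d xs). \<forall>m < H j. A_of f i m = A_of f j m)))"
    unfolding all_pred_iff bex less
    by (simp add: I_cover_axiom_def asat_total_form asat_cantor_form form_simps cong: conj_cong)
  then show ?thesis by blast
qed

lemma asat_I_extensional_axiom:
  "asat f s I_extensional_axiom \<longleftrightarrow> (\<forall>d xs H d' xs'.
     (\<forall>i. V_of f d (theta_code # fun_code i # xs) = Suc (H i)) \<longrightarrow>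
     (\<forall>i. V_of f d' (theta_code # fun_code i # xs') = Suc (H i)) \<longrightarrow> I_of f d xs = I_of f d' xs')"
proof -
  let ?v = "\<lambda>d xs i. V_of f d (theta_code # fun_code i # xs)"
  have "asat f s I_extensional_axiom \<longleftrightarrow> (\<forall>d xs d' xs'. (\<forall>i. ?v d xs i \<noteq> 0) \<longrightarrow>
     (\<forall>i. ?v d xs i = ?v d' xs' i) \<longrightarrow> I_of f d xs = I_of f d' xs')"
    by (simp add: I_extensional_axiom_def asat_total_form form_simps list_decode_eq)
  \<comment> \<open>As the first table is nowhere 0, the tables are equal exactly when the second is
    the successor of the predecessor of the first, which makes \<open>H\<close> common to
    both.\<close>
  also have "\<dots> \<longleftrightarrow> (\<forall>d xs d' xs'. (\<forall>i. ?v d xs i \<noteq> 0) \<longrightarrow>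
     (\<forall>i. ?v d' xs' i = Suc (?v d xs i - 1)) \<longrightarrow> I_of f d xs = I_of f d' xs')"
    by (intro all_cong1 imp_cong refl) (metis Suc_pred' neq0_conv)
  also have "\<dots> \<longleftrightarrow> (\<forall>d xs d' xs' H. (\<forall>i. ?v d xs i = Suc (H i)) \<longrightarrow>
     (\<forall>i. ?v d' xs' i = Suc (H i)) \<longrightarrow> I_of f d xs = I_of f d' xs')"
    unfolding all_pred_iff by (rule refl)
  finally show ?thesis by blast
qed

end

section \<open>A universal function quantifier over an arithmetical formula\<close>

definition model_axioms :: aform where
  "model_axioms = foldr Conj [zero_axiom, update_axiom, inj_axiom, S1_axiom, S2_axiom, S3_axiom,
     S4_axiom, S5_zero_axiom, S5_Suc_axiom, S6_axiom, S7_axiom, S8_axiom, S9_axiom, S10_axiom,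
     I_cantor_axiom, I_cover_axiom, I_extensional_axiom] coding_axioms"

lemma asat_model_axioms:
  "asat f s model_axioms \<longleftrightarrow> coding f \<and> fan_model (V_of f) (A_of f) (I_of f)"
proof (cases "coding f")
  case True
  show ?thesis
    unfolding fan_model_def model_axioms_def
    by (simp only: foldr.simps id_apply o_apply asat.simps asat_coding_axioms True simp_thms
        asat_zero_axiom asat_update_axiom asat_inj_axiom asat_S1_axiom asat_S2_axiom asat_S3_axiom
        asat_S4_axiom asat_S5_zero_axiom asat_S5_Suc_axiom asat_S6_axiom asat_S7_axiom asat_S8_axiom
        asat_S9_axiom asat_S10_axiom asat_I_cantor_axiom asat_I_cover_axiom asat_I_extensional_axiom conj_assoc)
next
  case False
  then show ?thesis by (simp add: model_axioms_def asat_coding_axioms)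
qed

text \<open>Mapping over a list is not a term, so variable 4 is the coded argument list, pinned down
  entry by entry.\<close>

definition failure_form :: aform where
  "failure_form = Exi 1 (ExL 2 (Exi 3 (ExL 4 (
     Conj (Eq (Var 0) (tabT 0 (Var 1) (tabT 0 (Var 2) (Var 3))))
     (Conj (Eq (lenT (Var 4)) (Succ (Succ (lenT (Var 2)))))
     (Conj (Eq (nthT (Var 4) Zero) thetaT)
     (Conj (Eq (nthT (Var 4) (numT 1)) muT)
     (Conj (All 5 (Imp (lessF (Var 5) (lenT (Var 2)))
        (Eq (nthT (Var 4) (Succ (Succ (Var 5)))) (objT 0 (nthT (Var 2) (Var 5))))))
     (Neg (Eq (valT (Var 1) (Var 4)) (Succ (Var 3))))))))))))"

lemma asat_failure_form:
  assumes "coding f"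
  shows "asat f s failure_form \<longleftrightarrow> (\<exists>e ys a. s 0 = triple_code (e, ys, a) \<and>
    V_of f e (theta_code # mu_code # map num_code ys) \<noteq> Suc a)"
proof -
  have args: "length zs = Suc (Suc (length ys)) \<and>
      (if 0 < length zs then zs ! 0 else 0) = theta_code \<and>
      (if 1 < length zs then zs ! 1 else 0) = mu_code \<and>
      (\<forall>i<length ys. (if Suc (Suc i) < length zs then zs ! Suc (Suc i) else 0) =
         num_code (if i < length ys then ys ! i else 0)) \<longleftrightarrow>
      zs = theta_code # mu_code # map num_code ys" (is "?L zs \<longleftrightarrow> ?R zs") for zs ys :: "nat list"
  proof
    assume L: "?L zs"
    then obtain u v ws where zs: "zs = u # v # ws"
      by (metis length_Suc_conv)
    with L show "?R zs" by (auto intro!: nth_equalityI)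
  qed simp
  have "asat f s failure_form \<longleftrightarrow> (\<exists>e ys a zs. s 0 = triple_code (e, ys, a) \<and>
      zs = theta_code # mu_code # map num_code ys \<and> V_of f e zs \<noteq> Suc a)"
    unfolding args[symmetric] using assms
    by (simp add: failure_form_def coding_simps objT_def valT_def Let_def conj_assoc)
  then show ?thesis by blast
qed

lemma triple_code_eq_iff [simp]: "triple_code t = triple_code t' \<longleftrightarrow> t = t'"
  by (cases t; cases t') (simp add: list_encode_eq)

lemma triple_code_surj: "\<exists>e ys a. n = triple_code (e, ys, a)"
  by (metis list_decode_inverse prod_decode_inverse surj_pair triple_code.simps)

lemma ex_tables:
  "\<exists>f. coding f \<and> V_of f = V \<and> A_of f = A \<and> I_of f = I"
proof -
  obtain f where f: "tab f = (\<lambda>k x y.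
      if k = 0 then prod_encode (x, y)
      else if k = 1 then if x < y then 1 else 0
      else if k = 2 then length (list_decode x)
      else if k = 3 then if y < length (list_decode x) then list_decode x ! y else 0
      else if k = 4 then V x (list_decode y)
      else if k = 5 then A x y
      else list_encode (I x (list_decode y)))"
    using ex_tab by blast
  show ?thesis
    by (rule exI[of _ f]) (simp add: f coding_def fun_eq_iff)
qed

theorem theorem3p3:
  "Pi11 (triple_code `
     {(e, ys, a). \<forall>\<Theta>. special_fan \<Theta> \<longrightarrow>
        kleene e (O3 (fan_code \<Theta>) # O2 feferman_mu # map O0 ys) a})"
  unfolding Pi11_def
proof (intro exI allI)
  fix n
  obtain e ys a where n: "n = triple_code (e, ys, a)"
    using triple_code_surj by blast
  let ?comp = "\<lambda>\<Theta>. kleene e (O3 (fan_code \<Theta>) # O2 feferman_mu # map O0 ys) a"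
  let ?fails = "\<lambda>V. V e (theta_code # mu_code # map num_code ys) \<noteq> Suc a"
  \<comment> \<open>From left to right, take the hull of a counterexample. From right to left, take
    \<open>theta\<close> of the model: by \<open>kleene_imp_V\<close>, a computation with value
    \<open>a\<close> would be recorded in the table.\<close>
  have ex_iff: "(\<exists>\<Theta>. special_fan \<Theta> \<and> \<not> ?comp \<Theta>) \<longleftrightarrow>
      (\<exists>f. coding f \<and> fan_model (V_of f) (A_of f) (I_of f) \<and> ?fails (V_of f))"
  proof
    assume "\<exists>\<Theta>. special_fan \<Theta> \<and> \<not> ?comp \<Theta>"
    then obtain V A I where "fan_model V A I" "?fails V"
      using ex_fan_model by blast
    moreover obtain f where "coding f" "V_of f = V" "A_of f = A" "I_of f = I"
      using ex_tables by blast
    ultimately have "coding f \<and> fan_model (V_of f) (A_of f) (I_of f) \<and> ?fails (V_of f)"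
      by metis
    then show "\<exists>f. coding f \<and> fan_model (V_of f) (A_of f) (I_of f) \<and> ?fails (V_of f)" by blast
  next
    assume "\<exists>f. coding f \<and> fan_model (V_of f) (A_of f) (I_of f) \<and> ?fails (V_of f)"
    then obtain f where "fan_model (V_of f) (A_of f) (I_of f)" and fails: "?fails (V_of f)"
      by blast
    then interpret fan_model "V_of f" "A_of f" "I_of f" by simp
    let ?\<Phi> = "O3 (fan_code theta) # O2 feferman_mu # map O0 ys"
    have "set ?\<Phi> \<subseteq> args" "map obj_code ?\<Phi> = theta_code # mu_code # map num_code ys"
      by (auto simp: args_def)
    then have "\<not> ?comp theta"
      using kleene_imp_V[of e ?\<Phi> a] fails by metis
    then show "\<exists>\<Theta>. special_fan \<Theta> \<and> \<not> ?comp \<Theta>"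
      using special_fan_theta by blast
  qed
  have sat: "asat f ((\<lambda>_. 0)(0 := n)) (Conj model_axioms failure_form) \<longleftrightarrow>
      coding f \<and> fan_model (V_of f) (A_of f) (I_of f) \<and> ?fails (V_of f)" for f
  proof -
    have "asat f ((\<lambda>_. 0)(0 := n)) failure_form \<longleftrightarrow> ?fails (V_of f)" if "coding f"
      unfolding asat_failure_form[OF that] fun_upd_same n triple_code_eq_iff by blast
    then show ?thesis unfolding asat.simps asat_model_axioms by blast
  qed
  have "inj triple_code"
    by (simp only: inj_def triple_code_eq_iff simp_thms)
  then have mem: "n \<in> triple_code ` {(e, ys, a). \<forall>\<Theta>. special_fan \<Theta> \<longrightarrow>
        kleene e (O3 (fan_code \<Theta>) # O2 feferman_mu # map O0 ys) a} \<longleftrightarrow>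
      (\<forall>\<Theta>. special_fan \<Theta> \<longrightarrow> ?comp \<Theta>)"
    unfolding n by (simp only: inj_image_mem_iff mem_Collect_eq prod.case)
  \<comment> \<open>The complement is given by an existential quantifier over \<open>f\<close>;
    negating the formula makes it universal.\<close>
  show "n \<in> triple_code ` {(e, ys, a). \<forall>\<Theta>. special_fan \<Theta> \<longrightarrow>
        kleene e (O3 (fan_code \<Theta>) # O2 feferman_mu # map O0 ys) a} \<longleftrightarrow>
      (\<forall>f. asat f ((\<lambda>_. 0)(0 := n)) (Neg (Conj model_axioms failure_form)))"
    unfolding mem asat.simps(2) sat
    using arg_cong[OF ex_iff, of Not] by (simp only: not_ex de_Morgan_conj not_not imp_conv_disj)
qed

end
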